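(* Let $G$ be a finite simple graph with maximum degree $\Delta$. Then $\chi_{gl}''(G)\le \Delta+\operatorname{col}(G)-1$.
   Context: All graphs are finite and simple. Let $H$ be a graph with an arbitrary fixed orientation and $A$ a group written additively. For $f:E(H)\to A$ and a list assignment $L:V(H)\to 2^A$, an $(A,L,f)$-coloring of $H$ is a map $c:V(H)\to A$ with $c(v)\in L(v)$ for all $v$ and $c(x)-c(y)\neq f(xy)$ for every edge directed from $x$ to $y$. $H$ is $k$-group choosable if for every group $A$ with $|A|\ge k$, every list assignment $L$ with $|L(v)|=k$ for all $v$, and every $f:E(H)\to A$, an $(A,L,f)$-coloring exists; $\chi_{gl}(H)$ is the least such $k$. The total graph $T(G)$ has vertex set $V(G)\cup E(G)$, two elements adjacent iff they are adjacent or incident in $G$; $\chi_{gl}''(G)=\chi_{gl}(T(G))$. The coloring number $\operatorname{col}(G)$ is the smallest integer $m$ such that there is an ordering of $V(G)$ in which each vertex has at most $m-1$ neighbors among vertices of smaller index.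
   Formalization: The hypothesis Δ ≥ 2 is added, since the bound fails for Δ ≤ 1: for a single edge Δ + col(G) − 1 = 2 but T(G) is a triangle with group choice number 3, and for nonempty edgeless graphs the bound is 0. *)

theory Defs
  imports "HOL-Algebra.Generated_Groups" "HOL-Algebra.Weak_Morphisms" "HOL-Library.Countable_Set"
begin

type_synonym 'v ugraph = "'v set \<times> 'v set set"

abbreviation verts :: "'v ugraph \<Rightarrow> 'v set" where "verts \<equiv> fst"
abbreviation edges :: "'v ugraph \<Rightarrow> 'v set set" where "edges \<equiv> snd"

definition simple_graph :: "'v ugraph \<Rightarrow> bool" where
  "simple_graph G \<longleftrightarrow> finite (verts G) \<and> (\<forall>e\<in>edges G. e \<subseteq> verts G \<and> card e = 2)"

definition neighbors :: "'v ugraph \<Rightarrow> 'v \<Rightarrow> 'v set" where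
  "neighbors G v = {u \<in> verts G. {u, v} \<in> edges G}"

definition degree :: "'v ugraph \<Rightarrow> 'v \<Rightarrow> nat" where
  "degree G v = card (neighbors G v)"

(* The inserted 0 only matters for the graph without vertices. *)
definition max_degree :: "'v ugraph \<Rightarrow> nat" where
  "max_degree G = Max (insert 0 (degree G ` verts G))"

(* An ordering is a numbering by 0, ..., n - 1. "At most m - 1" is written "< m", because
   natural-number subtraction would also admit m = 0 for edgeless graphs. *)
definition coloring_number :: "'v ugraph \<Rightarrow> nat" where
  "coloring_number G =
    (LEAST m. \<exists>\<sigma>. bij_betw \<sigma> (verts G) {..<card (verts G)} \<and>
       (\<forall>v\<in>verts G. card {u \<in> neighbors G v. \<sigma> u < \<sigma> v} < m))"

definition total_graph :: "'v ugraph \<Rightarrow> ('v + 'v set) ugraph" where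
  "total_graph G =
    (Inl ` verts G \<union> Inr ` edges G,
     {{Inl u, Inl v} | u v. {u, v} \<in> edges G}
     \<union> {{Inr e, Inr e'} | e e'. e \<in> edges G \<and> e' \<in> edges G \<and> e \<noteq> e' \<and> e \<inter> e' \<noteq> {}}
     \<union> {{Inl v, Inr e} | v e. e \<in> edges G \<and> v \<in> e})"

definition orientation :: "'v ugraph \<Rightarrow> ('v \<times> 'v) set \<Rightarrow> bool" where
  "orientation H D \<longleftrightarrow>
    (\<forall>(x, y)\<in>D. {x, y} \<in> edges H) \<and>
    (\<forall>e\<in>edges H. \<exists>!p. p \<in> D \<and> e = {fst p, snd p})"

(* Groups need not be abelian; the additive c x - c y is c x \<otimes> inv (c y) in the
   multiplicative notation of the library. *)
definition group_coloring ::
  "'v ugraph \<Rightarrow> ('v \<times> 'v) set \<Rightarrow> 'g monoid \<Rightarrow> ('v \<Rightarrow> 'g set) \<Rightarrow> ('v set \<Rightarrow> 'g) \<Rightarrow> ('v \<Rightarrow> 'g) \<Rightarrow> bool"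
where
  "group_coloring H D A L f c \<longleftrightarrow>
    (\<forall>v\<in>verts H. c v \<in> L v) \<and>
    (\<forall>(x, y)\<in>D. c x \<otimes>\<^bsub>A\<^esub> inv\<^bsub>A\<^esub> (c y) \<noteq> f {x, y})"

(* The carriers of the groups range over subsets of the type 'g. The type nat already covers
   all groups, see lemma group_choosable_nat below. The disjunct "infinite" is needed because card
   is 0 on infinite sets, and "finite (L v)" for the same reason when k = 0. *)
definition group_choosable :: "'g itself \<Rightarrow> 'v ugraph \<Rightarrow> nat \<Rightarrow> bool" where
  "group_choosable TYPE('g) H k \<longleftrightarrow>
    (\<forall>(A :: 'g monoid) D L f.
       group A \<and> (infinite (carrier A) \<or> k \<le> card (carrier A)) \<and> orientation H D \<and>
       (\<forall>v\<in>verts H. L v \<subseteq> carrier A \<and> finite (L v) \<and> card (L v) = k) \<and>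
       (\<forall>e\<in>edges H. f e \<in> carrier A)
       \<longrightarrow> (\<exists>c. group_coloring H D A L f c))"

definition group_choice_number :: "'g itself \<Rightarrow> 'v ugraph \<Rightarrow> nat" where
  "group_choice_number TYPE('g) H = (LEAST k. group_choosable TYPE('g) H k)"

definition total_group_choice_number :: "'g itself \<Rightarrow> 'v ugraph \<Rightarrow> nat" where
  "total_group_choice_number TYPE('g) G = group_choice_number TYPE('g) (total_graph G)"

lemma (in group) countable_generate:
  assumes "countable S" "S \<subseteq> carrier G"
  shows "countable (generate G S)"
proof -
  let ?T = "insert \<one> (S \<union> (\<lambda>x. inv x) ` S)"
  let ?m = "\<lambda>xs. foldr (\<lambda>x y. x \<otimes> y) xs \<one>"
  have T: "?T \<subseteq> carrier G" using assms by auto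
  have cl: "?m xs \<in> carrier G" if "xs \<in> lists ?T" for xs
    using that T by (induction xs) auto
  have app: "?m (xs @ ys) = ?m xs \<otimes> ?m ys" if "xs \<in> lists ?T" "ys \<in> lists ?T" for xs ys
    using that
  proof (induction xs)
    case Nil
    then show ?case using cl by simp
  next
    case (Cons x xs)
    then have "x \<in> carrier G" using T by auto
    moreover have "?m xs \<in> carrier G" "?m ys \<in> carrier G"
      by (rule cl, use Cons in simp)+
    ultimately show ?case using Cons by (simp add: m_assoc)
  qed
  have "generate G S \<subseteq> ?m ` lists ?T"
  proof
    fix h assume "h \<in> generate G S"
    then show "h \<in> ?m ` lists ?T"
    proof induction
      case one
      show ?case by (rule image_eqI[of _ _ "[]"]) auto
    next
      case (incl h)
      then show ?case using assms by (intro image_eqI[of _ _ "[h]"]) auto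
    next
      case (inv h)
      then show ?case using assms by (intro image_eqI[of _ _ "[inv h]"]) auto
    next
      case (eng h1 h2)
      then obtain xs ys where "xs \<in> lists ?T" "h1 = ?m xs" "ys \<in> lists ?T" "h2 = ?m ys"
        by blast
      then show ?case using app by (intro image_eqI[of _ _ "xs @ ys"]) auto
    qed
  qed
  moreover have "countable (?m ` lists ?T)" using assms(1) by auto
  ultimately show ?thesis by (rule countable_subset)
qed

lemma group_choosable_nat:
  fixes H :: "'v ugraph"
  assumes ch: "group_choosable TYPE(nat) H k" and sg: "simple_graph H"
  shows "group_choosable TYPE('g) H k"
  unfolding group_choosable_def
proof (intro allI impI, elim conjE)
  fix A :: "'g monoid" and D L f
  assume A: "group A" and D: "orientation H D"
    and L: "\<forall>v\<in>verts H. L v \<subseteq> carrier A \<and> finite (L v) \<and> card (L v) = k"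
    and f: "\<forall>e\<in>edges H. f e \<in> carrier A"
  interpret A: group A by fact
  define S where "S = (\<Union>v\<in>verts H. L v) \<union> f ` edges H"
  have fin: "finite (verts H)" and ed: "\<And>e. e \<in> edges H \<Longrightarrow> e \<subseteq> verts H"
    using sg by (auto simp: simple_graph_def)
  have "finite (edges H)"
    by (rule finite_subset[of _ "Pow (verts H)"]) (use fin ed in auto)
  then have S: "finite S" "S \<subseteq> carrier A" using L f fin by (auto simp: S_def)
  define C where "C = generate A S"
  have C: "subgroup C A" and SC: "S \<subseteq> C" and cC: "countable C"
    using A.generate_is_subgroup[OF S(2)] A.countable_generate[OF _ S(2)] S(1)
    by (auto simp: C_def countable_finite intro: generate.incl)
  define B where "B = A\<lparr>carrier := C\<rparr>"
  have B: "group B" using C A by (simp add: B_def subgroup.subgroup_is_group)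
  interpret B: group B by fact
  obtain h :: "'g \<Rightarrow> nat" where h: "inj_on h C" using cC by (auto simp: countable_def)
  have cB: "carrier B = C" by (simp add: B_def)
  define N where "N = image_group h B"
  have N: "group N" and iso: "h \<in> iso B N"
    using B.inj_imp_image_group_is_group[of h] inj_imp_image_group_iso[of h B] h
    by (simp_all add: N_def cB)
  interpret N: group N by fact
  interpret h: group_hom B N h
    using iso by unfold_locales (simp add: iso_def)
  have cN: "carrier N = h ` C" by (simp add: N_def image_group_carrier cB)
  show "\<exists>c. group_coloring H D A L f c"
  proof (cases "verts H = {}")
    case True
    then have "edges H = {}" using sg by (auto simp: simple_graph_def)
    then show ?thesis using D True by (auto simp: orientation_def group_coloring_def)
  next
    case False
    then obtain v0 where "v0 \<in> verts H" by auto
    have LC: "L v \<subseteq> C" if "v \<in> verts H" for v using that SC by (auto simp: S_def)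
    have fC: "f e \<in> C" if "e \<in> edges H" for e using that SC by (auto simp: S_def)
    have card: "infinite (carrier N) \<or> k \<le> card (carrier N)"
    proof -
      have "k \<le> card C" if "finite C"
        using card_mono[OF that LC[OF \<open>v0 \<in> verts H\<close>]] L \<open>v0 \<in> verts H\<close> by simp
      then show ?thesis using h by (auto simp: cN card_image finite_image_iff)
    qed
    have Lh: "\<forall>v\<in>verts H. h ` L v \<subseteq> carrier N \<and> finite (h ` L v) \<and> card (h ` L v) = k"
    proof
      fix v assume v: "v \<in> verts H"
      then show "h ` L v \<subseteq> carrier N \<and> finite (h ` L v) \<and> card (h ` L v) = k"
        using L image_mono[OF LC[OF v]] card_image[OF inj_on_subset[OF h LC[OF v]]] by (simp add: cN)
    qed
    have fh: "\<forall>e\<in>edges H. h (f e) \<in> carrier N" using fC by (auto simp: cN)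
    from ch[unfolded group_choosable_def, rule_format, of N D "\<lambda>v. h ` L v" "\<lambda>e. h (f e)"]
      N card D Lh fh
    obtain c where c: "group_coloring H D N (\<lambda>v. h ` L v) (\<lambda>e. h (f e)) c" by auto
    define c' where "c' v = inv_into C h (c v)" for v
    have c': "c' v \<in> L v" "h (c' v) = c v" if "v \<in> verts H" for v
    proof -
      have "c v \<in> h ` L v" using c that by (auto simp: group_coloring_def)
      then obtain a where "a \<in> L v" "c v = h a" by auto
      then show "c' v \<in> L v" "h (c' v) = c v" using h LC[OF that] by (auto simp: c'_def)
    qed
    have "c' x \<otimes>\<^bsub>A\<^esub> inv\<^bsub>A\<^esub> c' y \<noteq> f {x, y}" if xy: "(x, y) \<in> D" for x y
    proof
      assume eq: "c' x \<otimes>\<^bsub>A\<^esub> inv\<^bsub>A\<^esub> c' y = f {x, y}"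
      have e: "{x, y} \<in> edges H" using D xy by (auto simp: orientation_def)
      then have xyv: "x \<in> verts H" "y \<in> verts H" using ed by auto
      then have cC: "c' x \<in> carrier B" "c' y \<in> carrier B" using c' LC by (auto simp: cB)
      have "inv\<^bsub>B\<^esub> c' y = inv\<^bsub>A\<^esub> c' y"
        using A.m_inv_consistent[OF C] cC by (simp add: B_def)
      then have "c' x \<otimes>\<^bsub>B\<^esub> inv\<^bsub>B\<^esub> c' y = f {x, y}" using eq by (simp add: B_def)
      then have "c x \<otimes>\<^bsub>N\<^esub> inv\<^bsub>N\<^esub> c y = h (f {x, y})"
        using cC c'(2)[OF xyv(1)] c'(2)[OF xyv(2)] B.inv_closed h.hom_mult h.hom_inv by metis
      then show False using c xy by (auto simp: group_coloring_def)
    qed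
    then have "group_coloring H D A L f c'" using c' by (auto simp: group_coloring_def)
    then show ?thesis by blast
  qed
qed

end

theory Submission
  imports Defs
begin

text \<open>Let \<open>k = \<Delta> + col(G) - 1\<close> and suppose that \<open>S\<close> is a minimal uncolorable set of elements of
  the total graph. Greedy extension shows that every element of \<open>S\<close> has at least \<open>k\<close> neighbors
  in \<open>S\<close>. If \<open>col(G) \<le> \<Delta>\<close>, order the vertices of \<open>G\<close> and place each edge at its later end, just
  before that vertex: the last element of \<open>S\<close> then has fewer than \<open>k\<close> neighbors in \<open>S\<close>. Otherwise
  \<open>k \<ge> 2\<Delta>\<close> bounds all degrees of the total graph, so \<open>S\<close> is closed under adjacency and,
  as \<open>k \<ge> 4\<close>, contains \<open>u\<close>, \<open>v\<close>, \<open>uv\<close>, \<open>uw\<close> for some vertex \<open>u\<close> with two neighbors \<open>v\<close>, \<open>w\<close>. These four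
  elements induce \<open>K\<^sub>4\<close> minus an edge. By minimality the rest of \<open>S\<close> is colorable, and any such
  coloring extends: the lists left at \<open>u\<close> and \<open>v\<close> have sizes at least 3 and 2, so \<open>u\<close> can be
  colored such that \<open>v\<close> keeps two colors, after which \<open>uw\<close>, \<open>uv\<close>, \<open>v\<close> are colored greedily.\<close>

section \<open>Colorings avoiding conflicts\<close>

text \<open>This is correspondence coloring (DP-coloring): \<open>conf_unique\<close> and
  \<open>conf_sym\<close> make the conflicts between the lists of two elements a partial matching.
  Apart from adjacency, this is all that the counting arguments use of the group, the orientation
  and \<open>f\<close>.\<close>

locale conflict_system =
  fixes adj :: "'a \<Rightarrow> 'a \<Rightarrow> bool"
    and L :: "'a \<Rightarrow> 'c set"
    and conf :: "'a \<Rightarrow> 'c \<Rightarrow> 'a \<Rightarrow> 'c \<Rightarrow> bool"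
  assumes adj_irrefl: "\<not> adj x x"
    and conf_adj: "conf x \<alpha> y \<beta> \<Longrightarrow> adj x y"
    and conf_sym: "conf x \<alpha> y \<beta> \<Longrightarrow> conf y \<beta> x \<alpha>"
    and conf_unique: "\<lbrakk>\<alpha> \<in> L x; \<beta> \<in> L y; \<beta>' \<in> L y; conf x \<alpha> y \<beta>; conf x \<alpha> y \<beta>'\<rbrakk> \<Longrightarrow> \<beta> = \<beta>'"
begin

definition proper :: "'a set \<Rightarrow> ('a \<Rightarrow> 'c) \<Rightarrow> bool" where
  "proper S c \<longleftrightarrow> (\<forall>v\<in>S. c v \<in> L v) \<and> (\<forall>u\<in>S. \<forall>v\<in>S. \<not> conf u (c u) v (c v))"

definition avail :: "'a set \<Rightarrow> ('a \<Rightarrow> 'c) \<Rightarrow> 'a \<Rightarrow> 'c set" where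
  "avail S c v = {\<beta> \<in> L v. \<forall>u\<in>S. \<not> conf u (c u) v \<beta>}"

definition critical :: "'a set \<Rightarrow> bool" where
  "critical S \<longleftrightarrow> finite S \<and> \<not> (\<exists>c. proper S c) \<and> (\<forall>T. T \<subset> S \<longrightarrow> (\<exists>c. proper T c))"

text \<open>Finiteness is a separate conclusion because \<open>card\<close> is 0 on infinite sets
  and the lists may be infinite here.\<close>

lemma card_conflicts_le_1:
  assumes "\<alpha> \<in> L x"
  shows "card {\<beta> \<in> L y. conf x \<alpha> y \<beta>} \<le> 1" "finite {\<beta> \<in> L y. conf x \<alpha> y \<beta>}"
proof -
  have "\<exists>\<beta>. {\<beta> \<in> L y. conf x \<alpha> y \<beta>} \<subseteq> {\<beta>}"
  proof (cases "{\<beta> \<in> L y. conf x \<alpha> y \<beta>} = {}")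
    case False
    then obtain \<beta> where "\<beta> \<in> L y" "conf x \<alpha> y \<beta>" by auto
    then have "{\<beta> \<in> L y. conf x \<alpha> y \<beta>} \<subseteq> {\<beta>}" using conf_unique[OF assms] by blast
    then show ?thesis ..
  qed blast
  then obtain \<beta> where *: "{\<beta> \<in> L y. conf x \<alpha> y \<beta>} \<subseteq> {\<beta>}" ..
  from card_mono[OF _ *] show "card {\<beta> \<in> L y. conf x \<alpha> y \<beta>} \<le> 1" by simp
  from finite_subset[OF *] show "finite {\<beta> \<in> L y. conf x \<alpha> y \<beta>}" by simp
qed

lemma proper_insert:
  assumes "proper S c" "v \<notin> S" "\<beta> \<in> avail S c v"
  shows "proper (insert v S) (c(v := \<beta>))"
proof -
  \<comment> \<open>\<open>proper\<close> also ranges over pairs of equal elements; irreflexivity of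
    \<open>adj\<close> settles these.\<close>
  have "\<not> conf v \<beta> v \<beta>" using conf_adj adj_irrefl by blast
  moreover have "\<not> conf u (c u) v \<beta>" "\<not> conf v \<beta> u (c u)" if "u \<in> S" for u
    using assms(3) that conf_sym by (auto simp: avail_def)
  ultimately show ?thesis
    using assms by (auto simp: proper_def avail_def)
qed

lemma avail_insert:
  assumes "v \<notin> S"
  shows "avail (insert v S) (c(v := \<beta>)) w = avail S c w - {\<gamma> \<in> L w. conf v \<beta> w \<gamma>}"
  using assms by (auto simp: avail_def)

lemma avail_insert_nonadj:
  assumes "v \<notin> S" "\<not> adj v w"
  shows "avail (insert v S) (c(v := \<beta>)) w = avail S c w"
  using assms conf_adj by (auto simp: avail_def)

lemma card_avail_insert:
  assumes "v \<notin> S" "\<beta> \<in> L v"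
  shows "card (avail S c w) \<le> card (avail (insert v S) (c(v := \<beta>)) w) + 1"
proof -
  have "card (avail S c w) - card {\<gamma> \<in> L w. conf v \<beta> w \<gamma>}
      \<le> card (avail S c w - {\<gamma> \<in> L w. conf v \<beta> w \<gamma>})"
    by (rule diff_card_le_card_Diff) (rule card_conflicts_le_1[OF assms(2)])
  then show ?thesis
    using card_conflicts_le_1(1)[OF assms(2), of w] unfolding avail_insert[OF assms(1)] by linarith
qed

text \<open>Each colored neighbor of \<open>w\<close> blocks at most one color of its list. If the
  list is infinite, its \<open>card\<close> is 0 and the bound is trivial.\<close>

lemma card_avail:
  assumes "proper S c" "finite S"
  shows "card (L w) \<le> card (avail S c w) + card {u \<in> S. adj u w}"
proof (cases "finite (L w)")
  case True
  let ?N = "{u \<in> S. adj u w}"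
  let ?C = "\<lambda>u. {\<beta> \<in> L w. conf u (c u) w \<beta>}"
  have "card (L w) \<le> card (avail S c w \<union> (\<Union>u\<in>?N. ?C u))"
    by (rule card_mono) (use True conf_adj assms(2) in \<open>auto simp: avail_def\<close>)
  also have "\<dots> \<le> card (avail S c w) + card (\<Union>u\<in>?N. ?C u)" by (rule card_Un_le)
  also have "card (\<Union>u\<in>?N. ?C u) \<le> (\<Sum>u\<in>?N. card (?C u))"
    using assms(2) by (intro card_UN_le) auto
  also have "\<dots> \<le> (\<Sum>u\<in>?N. 1)"
    using assms(1) by (intro sum_mono card_conflicts_le_1(1)) (auto simp: proper_def)
  finally show ?thesis by simp
qed simp

section \<open>Minimal uncolorable sets\<close>

lemma critical_subset_exists:
  assumes "finite S" "\<not> (\<exists>c. proper S c)"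
  obtains T where "T \<subseteq> S" "critical T"
proof -
  let ?P = "\<lambda>T. T \<subseteq> S \<and> \<not> (\<exists>c. proper T c)"
  obtain T where T: "?P T" "\<And>U. ?P U \<Longrightarrow> card T \<le> card U"
    using ex_has_least_nat[of ?P S card] assms(2) by blast
  have "finite T" using T(1) assms(1) finite_subset by blast
  moreover have "\<exists>c. proper U c" if "U \<subset> T" for U
    using T(1) T(2)[of U] psubset_card_mono[OF \<open>finite T\<close> that] that by fastforce
  ultimately show thesis using that T(1) by (auto simp: critical_def)
qed

lemma critical_subset_proper: "critical S \<Longrightarrow> T \<subset> S \<Longrightarrow> \<exists>c. proper T c"
  unfolding critical_def by (elim conjE) (erule allE, erule (1) mp)

lemma critical_nonempty: "critical S \<Longrightarrow> S \<noteq> {}"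
  by (auto simp: critical_def proper_def)

text \<open>By minimality \<open>S - {v}\<close> has a coloring. A color available at
  \<open>v\<close> would extend it to \<open>S\<close>, so the neighbors of \<open>v\<close> in
  \<open>S\<close> block the whole list.\<close>

lemma critical_degree:
  assumes "critical S" "v \<in> S"
  shows "card (L v) \<le> card {u \<in> S. adj u v}"
proof -
  have "S - {v} \<subset> S" "finite (S - {v})" using assms by (auto simp: critical_def)
  then obtain c where c: "proper (S - {v}) c" using critical_subset_proper[OF assms(1)] by blast
  have "avail (S - {v}) c v = {}"
  proof (rule ccontr)
    assume "avail (S - {v}) c v \<noteq> {}"
    then obtain \<beta> where "\<beta> \<in> avail (S - {v}) c v" by blast
    from proper_insert[OF c _ this] have "proper S (c(v := \<beta>))" using assms(2) by (simp add: insert_absorb)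
    then show False using assms(1) by (auto simp: critical_def)
  qed
  then have "card (L v) \<le> card {u \<in> S - {v}. adj u v}"
    using card_avail[OF c \<open>finite (S - {v})\<close>, of v] by simp
  also have "{u \<in> S - {v}. adj u v} = {u \<in> S. adj u v}" using adj_irrefl by auto
  finally show ?thesis .
qed

text \<open>The only non-adjacent pair is \<open>a\<close>, \<open>b\<close>. By \<open>deg\<close>,
  each of the four keeps at least as many colors as it has neighbors among the four. In the order
  \<open>x\<close>, \<open>b\<close>, \<open>y\<close>, \<open>a\<close> a greedy coloring can then
  get stuck only at \<open>a\<close>, and a careful choice at \<open>x\<close> prevents
  that.\<close>

lemma critical_no_diamond:
  assumes S: "critical S"
    and K: "{x, y, a, b} \<subseteq> S" "distinct [x, y, a, b]"
    and adj: "adj y x" "adj a x" "adj b x" "adj x y" "adj a y" "adj b y"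
      "adj x a" "adj y a" "adj x b" "adj y b" "\<not> adj b a"
    and deg: "\<And>z. z \<in> {x, y, a, b} \<Longrightarrow> card {u \<in> S. adj u z} \<le> card (L z)"
  shows False
proof -
  define R where "R = S - {x, y, a, b}"
  have "finite S" and fin: "finite R" and sub: "R \<subset> S" using S K by (auto simp: critical_def R_def)
  have out: "x \<notin> R" "b \<notin> insert x R" "y \<notin> insert b (insert x R)" "a \<notin> insert y (insert b (insert x R))"
    using K(2) by (auto simp: R_def)
  have full: "insert a (insert y (insert b (insert x R))) = S" using K(1) by (auto simp: R_def)
  obtain c where c: "proper R c" using critical_subset_proper[OF S sub] by blast
  \<comment> \<open>The elements of \<open>J\<close> are still uncolored, so at most the neighbors
    in \<open>R\<close> have used up colors of \<open>z\<close>; \<open>deg\<close> leaves one color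
    for each element of \<open>J\<close>.\<close>
  have left: "card J \<le> card (avail R c z)"
    if "z \<in> {x, y, a, b}" "J \<subseteq> {u \<in> {x, y, a, b}. adj u z}" for z J
  proof -
    have J: "finite J" using that(2) finite_subset by fastforce
    have "card J + card {u \<in> R. adj u z} = card (J \<union> {u \<in> R. adj u z})"
      using that(2) fin J by (intro card_Un_disjoint[symmetric]) (auto simp: R_def)
    also have "\<dots> \<le> card {u \<in> S. adj u z}"
      using that(2) K(1) \<open>finite S\<close> by (intro card_mono) (auto simp: R_def)
    also have "\<dots> \<le> card (L z)" using deg that(1) by blast
    also have "\<dots> \<le> card (avail R c z) + card {u \<in> R. adj u z}" by (rule card_avail[OF c fin])
    finally show ?thesis by simp
  qed
  have lx: "3 \<le> card (avail R c x)" using left[of x "{y, a, b}"] adj K(2) by simp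
  have ly: "3 \<le> card (avail R c y)" using left[of y "{x, a, b}"] adj K(2) by simp
  have la: "2 \<le> card (avail R c a)" using left[of a "{x, y}"] adj K(2) by simp
  have lb: "2 \<le> card (avail R c b)" using left[of b "{x, y}"] adj K(2) by simp
  \<comment> \<open>If \<open>a\<close> has exactly two colors left, each of them conflicts with at
    most one color at \<open>x\<close>. These form \<open>?B\<close>, so one of the three or more
    colors at \<open>x\<close> lies outside \<open>?B\<close> and costs \<open>a\<close> nothing. If
    \<open>a\<close> has at least three, any color at \<open>x\<close> leaves two.\<close>
  have "\<exists>\<alpha> \<in> avail R c x. 2 \<le> card (avail (insert x R) (c(x := \<alpha>)) a)"
  proof (cases "card (avail R c a) = 2")
    case True
    let ?B = "\<Union>\<beta>\<in>avail R c a. {\<alpha> \<in> L x. conf a \<beta> x \<alpha>}"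
    have fa: "finite (avail R c a)" using True card.infinite by fastforce
    have La: "avail R c a \<subseteq> L a" by (auto simp: avail_def)
    have "card ?B \<le> (\<Sum>\<beta>\<in>avail R c a. card {\<alpha> \<in> L x. conf a \<beta> x \<alpha>})"
      using fa by (rule card_UN_le)
    also have "\<dots> \<le> (\<Sum>\<beta>\<in>avail R c a. 1)"
      using La by (intro sum_mono card_conflicts_le_1(1)) auto
    finally have "card ?B < card (avail R c x)" using True lx by simp
    moreover have "finite ?B" using fa La card_conflicts_le_1(2) by blast
    ultimately have "\<not> avail R c x \<subseteq> ?B" using card_mono leD by blast
    then obtain \<alpha> where \<alpha>: "\<alpha> \<in> avail R c x" "\<alpha> \<notin> ?B" by blast
    then have "avail (insert x R) (c(x := \<alpha>)) a = avail R c a"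
      using conf_sym unfolding avail_insert[OF out(1)] by (auto simp: avail_def)
    then show ?thesis using \<alpha>(1) True by (intro bexI[of _ \<alpha>]) simp_all
  next
    case False
    obtain \<alpha> where \<alpha>: "\<alpha> \<in> avail R c x" using lx by fastforce
    then have "\<alpha> \<in> L x" by (simp add: avail_def)
    from card_avail_insert[OF out(1) this, of c a] have "2 \<le> card (avail (insert x R) (c(x := \<alpha>)) a)"
      using False la by linarith
    then show ?thesis using \<alpha> by blast
  qed
  then obtain \<alpha> where \<alpha>: "\<alpha> \<in> avail R c x" "2 \<le> card (avail (insert x R) (c(x := \<alpha>)) a)" ..
  then have \<alpha>L: "\<alpha> \<in> L x" by (simp add: avail_def)
  define c1 where "c1 = c(x := \<alpha>)"
  have p1: "proper (insert x R) c1"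
    unfolding c1_def by (rule proper_insert[OF c out(1) \<alpha>(1)])
  have "1 \<le> card (avail (insert x R) c1 b)"
    using card_avail_insert[OF out(1) \<alpha>L, of c b] lb unfolding c1_def by linarith
  then obtain \<beta> where \<beta>: "\<beta> \<in> avail (insert x R) c1 b" by fastforce
  then have \<beta>L: "\<beta> \<in> L b" by (simp add: avail_def)
  define c2 where "c2 = c1(b := \<beta>)"
  have p2: "proper (insert b (insert x R)) c2"
    unfolding c2_def by (rule proper_insert[OF p1 out(2) \<beta>])
  have "1 \<le> card (avail (insert b (insert x R)) c2 y)"
    using card_avail_insert[OF out(1) \<alpha>L, of c y] card_avail_insert[OF out(2) \<beta>L, of c1 y] ly
    unfolding c1_def c2_def by linarith
  then obtain \<gamma> where \<gamma>: "\<gamma> \<in> avail (insert b (insert x R)) c2 y" by fastforce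
  then have \<gamma>L: "\<gamma> \<in> L y" by (simp add: avail_def)
  define c3 where "c3 = c2(y := \<gamma>)"
  have p3: "proper (insert y (insert b (insert x R))) c3"
    unfolding c3_def by (rule proper_insert[OF p2 out(3) \<gamma>])
  \<comment> \<open>After \<open>x\<close> is colored, \<open>a\<close> has two colors;
    \<open>b\<close> takes none of them, not being adjacent to \<open>a\<close>, and
    \<open>y\<close> takes at most one.\<close>
  have "1 \<le> card (avail (insert y (insert b (insert x R))) c3 a)"
    using card_avail_insert[OF out(3) \<gamma>L, of c2 a] \<alpha>(2)
      avail_insert_nonadj[OF out(2) adj(11), of c1 \<beta>]
    unfolding c1_def c2_def c3_def by simp
  then obtain \<delta> where "\<delta> \<in> avail (insert y (insert b (insert x R))) c3 a" by fastforce
  from proper_insert[OF p3 out(4) this] show False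
    using S unfolding full by (auto simp: critical_def)
qed

end

text \<open>Listing both directions of an edge makes the conflict relation symmetric; uniqueness of
  the conflicting color is cancellation in the group, which need not be abelian.\<close>

lemma conflict_system_orientation:
  assumes A: "group A" and D: "orientation H D"
    and loopless: "\<And>x. {x} \<notin> edges H"
    and L: "\<And>v. L v \<subseteq> carrier A"
  shows "conflict_system (\<lambda>x y. {x, y} \<in> edges H) L
    (\<lambda>x \<alpha> y \<beta>. (x, y) \<in> D \<and> \<alpha> \<otimes>\<^bsub>A\<^esub> inv\<^bsub>A\<^esub> \<beta> = f {x, y} \<or> (y, x) \<in> D \<and> \<beta> \<otimes>\<^bsub>A\<^esub> inv\<^bsub>A\<^esub> \<alpha> = f {x, y})"
    (is "conflict_system _ _ ?conf")
proof
  interpret group A by fact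
  have edge: "{x, y} \<in> edges H" if "(x, y) \<in> D" for x y
    using D that by (auto simp: orientation_def)
  fix x y \<alpha> \<beta> \<beta>'
  show "\<not> {x, x} \<in> edges H" using loopless by simp
  show "?conf x \<alpha> y \<beta> \<Longrightarrow> {x, y} \<in> edges H" using edge[of x y] edge[of y x] by (auto simp: insert_commute[of y x])
  show "?conf x \<alpha> y \<beta> \<Longrightarrow> ?conf y \<beta> x \<alpha>" by (auto simp: insert_commute)
  assume mem: "\<alpha> \<in> L x" "\<beta> \<in> L y" "\<beta>' \<in> L y" and c: "?conf x \<alpha> y \<beta>" "?conf x \<alpha> y \<beta>'"
  have car: "\<alpha> \<in> carrier A" "\<beta> \<in> carrier A" "\<beta>' \<in> carrier A" using mem L by blast+
  \<comment> \<open>With both directions in \<open>D\<close>, the two disjuncts could forbid two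
    different colors. An orientation allows this only for \<open>x = y\<close>, which would be a
    loop.\<close>
  have one: "\<not> ((x, y) \<in> D \<and> (y, x) \<in> D)"
  proof
    assume *: "(x, y) \<in> D \<and> (y, x) \<in> D"
    then have "\<exists>!p. p \<in> D \<and> {x, y} = {fst p, snd p}"
      using D edge by (auto simp: orientation_def)
    moreover have "{x, y} = {fst (x, y), snd (x, y)}" "{x, y} = {fst (y, x), snd (y, x)}" by auto
    ultimately have "(x, y) = (y, x)" using * by blast
    then have "x = y" by blast
    then have "{x} \<in> edges H" using edge[of x x] * by simp
    then show False using loopless by blast
  qed
  show "\<beta> = \<beta>'"
  proof (cases "(x, y) \<in> D")
    case True
    then have "\<alpha> \<otimes>\<^bsub>A\<^esub> inv\<^bsub>A\<^esub> \<beta> = \<alpha> \<otimes>\<^bsub>A\<^esub> inv\<^bsub>A\<^esub> \<beta>'" using c one by auto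
    then have "inv\<^bsub>A\<^esub> \<beta> = inv\<^bsub>A\<^esub> \<beta>'" using car by simp
    then show ?thesis using car by (metis inv_inv)
  next
    case False
    then have "\<beta> \<otimes>\<^bsub>A\<^esub> inv\<^bsub>A\<^esub> \<alpha> = \<beta>' \<otimes>\<^bsub>A\<^esub> inv\<^bsub>A\<^esub> \<alpha>" using c by auto
    then show ?thesis using car by simp
  qed
qed

section \<open>Neighborhoods in the total graph\<close>

definition incident :: "'v ugraph \<Rightarrow> 'v \<Rightarrow> 'v set set" where
  "incident G v = {e \<in> edges G. v \<in> e}"

lemma edge_cases:
  assumes "simple_graph G" "e \<in> edges G"
  obtains u v where "e = {u, v}" "u \<noteq> v" "u \<in> verts G" "v \<in> verts G"
  using assms by (auto simp: simple_graph_def card_2_iff)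

lemma edge_neq: "simple_graph G \<Longrightarrow> {u, v} \<in> edges G \<Longrightarrow> u \<noteq> v"
  by (auto simp: simple_graph_def)

lemma finite_edges: "simple_graph G \<Longrightarrow> finite (edges G)"
  by (rule finite_subset[of _ "Pow (verts G)"]) (auto simp: simple_graph_def)

lemma incident_eq:
  assumes "simple_graph G"
  shows "incident G v = (\<lambda>w. {w, v}) ` neighbors G v"
proof
  show "incident G v \<subseteq> (\<lambda>w. {w, v}) ` neighbors G v"
  proof
    fix e assume e: "e \<in> incident G v"
    then obtain a b where ab: "e = {a, b}" "a \<in> verts G" "b \<in> verts G"
      using edge_cases[OF assms] by (metis (lifting) incident_def mem_Collect_eq)
    then show "e \<in> (\<lambda>w. {w, v}) ` neighbors G v"
      using e by (auto simp: incident_def neighbors_def insert_commute)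
  qed
qed (auto simp: incident_def neighbors_def)

lemma finite_neighbors: "simple_graph G \<Longrightarrow> finite (neighbors G v)"
  by (simp add: simple_graph_def neighbors_def)

lemma finite_incident: "simple_graph G \<Longrightarrow> finite (incident G v)"
  by (simp add: incident_eq finite_neighbors)

lemma card_incident_le: "simple_graph G \<Longrightarrow> card (incident G v) \<le> degree G v"
  unfolding degree_def by (simp add: incident_eq card_image_le finite_neighbors)

lemma degree_le_max_degree:
  assumes "simple_graph G" "v \<in> verts G"
  shows "degree G v \<le> max_degree G"
  using assms by (auto simp: max_degree_def simple_graph_def intro: Max_ge)

lemma total_graph_adj:
  shows "{Inl u, Inl v} \<in> edges (total_graph G) \<longleftrightarrow> {u, v} \<in> edges G"
    and "{Inl v, Inr e} \<in> edges (total_graph G) \<longleftrightarrow> e \<in> incident G v"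
    and "{Inr e, Inl v} \<in> edges (total_graph G) \<longleftrightarrow> e \<in> incident G v"
    and "{Inr e, Inr e'} \<in> edges (total_graph G) \<longleftrightarrow>
      e \<in> edges G \<and> e' \<in> edges G \<and> e \<noteq> e' \<and> e \<inter> e' \<noteq> {}"
  by (auto simp: total_graph_def incident_def doubleton_eq_iff insert_commute)

lemma total_graph_verts:
  "Inl v \<in> verts (total_graph G) \<longleftrightarrow> v \<in> verts G"
  "Inr e \<in> verts (total_graph G) \<longleftrightarrow> e \<in> edges G"
  by (auto simp: total_graph_def)

lemma total_graph_loopless:
  assumes "simple_graph G"
  shows "{x} \<notin> edges (total_graph G)"
proof (cases x)
  case (Inl v)
  then show ?thesis using total_graph_adj(1)[of v v G] edge_neq[OF assms, of v v] by auto
next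
  case (Inr e)
  then show ?thesis using total_graph_adj(4)[of e e G] by auto
qed

abbreviation total_neighbors :: "'v ugraph \<Rightarrow> 'v + 'v set \<Rightarrow> ('v + 'v set) set" where
  "total_neighbors G z \<equiv> {u \<in> verts (total_graph G). {u, z} \<in> edges (total_graph G)}"

lemma total_graph_edge_verts:
  assumes "simple_graph G" "{x, y} \<in> edges (total_graph G)"
  shows "x \<in> verts (total_graph G)"
  using assms
  by (cases x; cases y) (auto simp: total_graph_adj total_graph_verts simple_graph_def incident_def)

lemma finite_total_graph: "simple_graph G \<Longrightarrow> finite (verts (total_graph G))"
  using finite_edges[of G] by (auto simp: total_graph_def simple_graph_def)

lemma total_neighbors_vertex:
  "total_neighbors G (Inl v) = Inl ` neighbors G v \<union> Inr ` incident G v"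
proof (rule Set.set_eqI)
  fix z
  show "z \<in> total_neighbors G (Inl v) \<longleftrightarrow> z \<in> Inl ` neighbors G v \<union> Inr ` incident G v"
    by (cases z) (auto simp: total_graph_adj neighbors_def total_graph_verts incident_def)
qed

lemma total_neighbors_edge:
  assumes "simple_graph G" "{u, v} \<in> edges G"
  shows "total_neighbors G (Inr {u, v}) =
    {Inl u, Inl v} \<union> Inr ` (incident G u - {{u, v}}) \<union> Inr ` (incident G v - {{u, v}})"
proof (rule Set.set_eqI)
  fix z
  have "u \<in> verts G" "v \<in> verts G" using assms by (auto simp: simple_graph_def)
  then show "z \<in> total_neighbors G (Inr {u, v}) \<longleftrightarrow> z \<in>
    {Inl u, Inl v} \<union> Inr ` (incident G u - {{u, v}}) \<union> Inr ` (incident G v - {{u, v}})"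
    using assms(2) by (cases z) (auto simp: total_graph_adj total_graph_verts incident_def)
qed

text \<open>A vertex has at most \<Delta> neighbors of each kind. An edge has its two ends and, at
  each end, at most \<Delta> - 1 other edges.\<close>

lemma card_total_neighbors_le:
  assumes G: "simple_graph G" and z: "z \<in> verts (total_graph G)"
  shows "card (total_neighbors G z) \<le> 2 * max_degree G"
proof (cases z)
  case (Inl v)
  then have "v \<in> verts G" using z by (simp add: total_graph_verts)
  have "card (total_neighbors G z) \<le> card (Inl ` neighbors G v :: ('a + 'a set) set)
      + card (Inr ` incident G v :: ('a + 'a set) set)"
    unfolding Inl total_neighbors_vertex by (rule card_Un_le)
  also have "\<dots> = degree G v + card (incident G v)" by (simp add: card_image degree_def)
  also have "\<dots> \<le> 2 * max_degree G"
    using card_incident_le[OF G, of v] degree_le_max_degree[OF G \<open>v \<in> verts G\<close>] by simp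
  finally show ?thesis .
next
  case (Inr e)
  then have e: "e \<in> edges G" using z by (simp add: total_graph_verts)
  then obtain u v where uv: "e = {u, v}" "u \<noteq> v" "u \<in> verts G" "v \<in> verts G"
    using edge_cases[OF G] by metis
  have inc: "card (incident G w - {e}) + 1 \<le> max_degree G" if "w \<in> {u, v}" for w
  proof -
    have "e \<in> incident G w" using e uv(1) that by (auto simp: incident_def)
    then have "card (incident G w - {e}) + 1 = card (incident G w)"
      using card_Suc_Diff1[OF finite_incident[OF G]] by simp
    also have "\<dots> \<le> max_degree G"
      using card_incident_le[OF G, of w] degree_le_max_degree[OF G, of w] that uv by auto
    finally show ?thesis .
  qed
  have "card (total_neighbors G z) \<le> card {Inl u, Inl v :: 'a + 'a set}
      + card (Inr ` (incident G u - {e}) :: ('a + 'a set) set)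
          + card (Inr ` (incident G v - {e}) :: ('a + 'a set) set)"
    unfolding Inr uv(1) total_neighbors_edge[OF G e[unfolded uv(1)]]
    using card_Un_le add_le_mono1 order_trans by meson
  also have "\<dots> \<le> 2 + card (incident G u - {e}) + card (incident G v - {e})"
    by (simp add: card_image card_insert_if)
  also have "\<dots> \<le> 2 * max_degree G" using inc[of u] inc[of v] by simp
  finally show ?thesis .
qed

section \<open>Orderings of the vertices and the case col(G) \<le> \<Delta>\<close>

lemma coloring_number_ordering:
  assumes "simple_graph G"
  obtains \<sigma> where "bij_betw \<sigma> (verts G) {..<card (verts G)}"
    "\<And>v. v \<in> verts G \<Longrightarrow> card {u \<in> neighbors G v. \<sigma> u < \<sigma> v} < coloring_number G"
proof -
  let ?P = "\<lambda>m. \<exists>\<sigma>. bij_betw \<sigma> (verts G) {..<card (verts G)} \<and>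
    (\<forall>v\<in>verts G. card {u \<in> neighbors G v. \<sigma> u < \<sigma> v} < m)"
  have fin: "finite (verts G)" using assms by (simp add: simple_graph_def)
  then obtain \<sigma> where "bij_betw \<sigma> (verts G) {0..<card (verts G)}"
    using ex_bij_betw_finite_nat by blast
  \<comment> \<open>A crude bound valid for every numbering; it shows that the \<open>LEAST\<close>
    is taken over a nonempty set and hence attained.\<close>
  moreover have "card {u \<in> neighbors G v. \<sigma> u < \<sigma> v} < Suc (card (verts G))" for v
    unfolding less_Suc_eq_le by (rule card_mono[OF fin]) (auto simp: neighbors_def)
  ultimately have "?P (Suc (card (verts G)))" by (auto simp: atLeast0LessThan)
  then have "?P (coloring_number G)" unfolding coloring_number_def by (rule LeastI)
  then show thesis using that by blast
qed

text \<open>No order on the total graph is built. Among the vertices that lie in \<open>S\<close> or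
  on an edge in \<open>S\<close>, take the last one, \<open>v\<close>. The required element is
  \<open>v\<close> itself if it lies in \<open>S\<close>, and otherwise any edge of \<open>S\<close>
  at \<open>v\<close>.\<close>

lemma total_graph_degenerate:
  assumes G: "simple_graph G" and S: "S \<subseteq> verts (total_graph G)" "S \<noteq> {}"
    and le: "coloring_number G \<le> max_degree G"
  shows "\<exists>z\<in>S. card {u \<in> S. {u, z} \<in> edges (total_graph G)} < max_degree G + coloring_number G - 1"
proof -
  obtain \<sigma> where bij: "bij_betw \<sigma> (verts G) {..<card (verts G)}"
    and few: "\<And>v. v \<in> verts G \<Longrightarrow> card {u \<in> neighbors G v. \<sigma> u < \<sigma> v} < coloring_number G"
    by (rule coloring_number_ordering[OF G]) blast
  have inj: "\<sigma> u = \<sigma> v \<Longrightarrow> u = v" if "u \<in> verts G" "v \<in> verts G" for u v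
    using bij that by (auto simp: bij_betw_def inj_on_def)
  define ends :: "'a + 'a set \<Rightarrow> 'a set" where "ends z = (case z of Inl v \<Rightarrow> {v} | Inr e \<Rightarrow> e)" for z
  have endsV: "ends z \<subseteq> verts G" if "z \<in> S" for z
    using subsetD[OF S(1) that] G by (cases z) (auto simp: ends_def total_graph_verts simple_graph_def)
  have endsne: "ends z \<noteq> {}" if "z \<in> S" for z
    using subsetD[OF S(1) that] G by (cases z) (auto simp: ends_def total_graph_verts simple_graph_def)
  have finV: "finite (verts G)" using G by (simp add: simple_graph_def)
  define U where "U = \<Union> (ends ` S)"
  have U: "U \<noteq> {}" "U \<subseteq> verts G"
    using endsV endsne S(2) by (auto simp: U_def)
  then have "finite U" using finV finite_subset by blast
  obtain v where vU: "v \<in> U" and vmax: "\<And>w. w \<in> U \<Longrightarrow> \<sigma> w \<le> \<sigma> v"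
    using Max_in[of "\<sigma> ` U"] Max_ge[of "\<sigma> ` U"] \<open>finite U\<close> U(1) by fastforce
  have v: "v \<in> verts G" using vU U(2) by blast
  define B where "B = {u \<in> neighbors G v. \<sigma> u < \<sigma> v}"
  have finB: "finite B" using finite_neighbors[OF G] by (simp add: B_def)
  have cB: "card B < coloring_number G" using few[OF v] by (simp add: B_def)
  have before: "w \<in> B" if "w \<in> neighbors G v" "w \<in> U" for w
  proof -
    have "w \<noteq> v" "w \<in> verts G" using that edge_neq[OF G] by (auto simp: neighbors_def)
    then show ?thesis using that(1) vmax[OF that(2)] inj[of w v] v by (fastforce simp: B_def)
  qed
  \<comment> \<open>The edges from \<open>v\<close> back to earlier neighbors. As \<open>v\<close>
    is last, every edge of \<open>S\<close> at \<open>v\<close> is among them, so there are fewer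
    than col(G).\<close>
  define E where "E = (\<lambda>w. {w, v}) ` B"
  have finE: "finite E" using finB by (simp add: E_def)
  have vert_before: "w \<in> B" if "w \<in> neighbors G v" "Inl w \<in> S" for w
    using that by (intro before) (force simp: U_def ends_def)+
  have edge_before: "e \<in> E" if e: "e \<in> incident G v" "Inr e \<in> S" for e
  proof -
    obtain w where w: "w \<in> neighbors G v" "e = {w, v}" using e incident_eq[OF G] by auto
    then have "w \<in> U" using e by (force simp: U_def ends_def)
    then have "w \<in> B" using w(1) before by blast
    then show ?thesis unfolding E_def w(2) by (rule imageI)
  qed
  have cBE: "card E \<le> card B" unfolding E_def by (rule card_image_le[OF finB])
  show ?thesis
  proof (cases "Inl v \<in> S")
    case True
    have "{u \<in> S. {u, Inl v} \<in> edges (total_graph G)} \<subseteq> S \<inter> total_neighbors G (Inl v)"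
      using S(1) by auto
    also have "\<dots> \<subseteq> Inl ` B \<union> Inr ` E"
      unfolding total_neighbors_vertex by (auto intro: vert_before edge_before)
    finally have "card {u \<in> S. {u, Inl v} \<in> edges (total_graph G)}
        \<le> card (Inl ` B \<union> Inr ` E :: ('a + 'a set) set)"
      using finB finE by (intro card_mono) auto
    also have "\<dots> \<le> card (Inl ` B :: ('a + 'a set) set)
        + card (Inr ` E :: ('a + 'a set) set)" by (rule card_Un_le)
    also have "\<dots> \<le> 2 * card B" using cBE by (simp add: card_image)
    \<comment> \<open>Here col(G) \<le> \<Delta> enters: 2(col(G) - 1) \<le> \<Delta> + col(G) -
      2.\<close>
    also have "\<dots> < max_degree G + coloring_number G - 1" using cB le by linarith
    finally show ?thesis using True by blast
  next
    case False
    obtain z where z: "z \<in> S" "v \<in> ends z" using vU by (auto simp: U_def)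
    with False obtain e where e: "z = Inr e" "v \<in> e" by (cases z) (auto simp: ends_def)
    then have inc: "e \<in> incident G v" using z S(1) by (auto simp: incident_def total_graph_verts)
    then have eE: "e \<in> E" using edge_before z e by blast
    then obtain u where u: "u \<in> B" "e = {u, v}" by (auto simp: E_def)
    then have uV: "u \<in> verts G" and uv: "{u, v} \<in> edges G" by (auto simp: B_def neighbors_def)
    have "{w \<in> S. {w, z} \<in> edges (total_graph G)} \<subseteq> S \<inter> total_neighbors G (Inr {u, v})"
      using S(1) e u by auto
    \<comment> \<open>Since \<open>v\<close> is not in \<open>S\<close>, only the end
      \<open>u\<close> is counted. With at most \<Delta> - 1 other edges at \<open>u\<close> and
      col(G) - 2 at \<open>v\<close>, the total is at most \<Delta> + col(G) - 2.\<close>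
    also have "\<dots> \<subseteq> {Inl u} \<union> Inr ` (incident G u - {e}) \<union> Inr ` (E - {e})"
      unfolding total_neighbors_edge[OF G uv] using False by (auto simp: u(2) intro: edge_before)
    finally have "card {w \<in> S. {w, z} \<in> edges (total_graph G)}
        \<le> card ({Inl u} \<union> Inr ` (incident G u - {e}) \<union> Inr ` (E - {e}) :: ('a + 'a set) set)"
      using finE finite_incident[OF G] by (intro card_mono) auto
    also have "\<dots> \<le> card {Inl u :: 'a + 'a set} + card (Inr ` (incident G u - {e}) :: ('a + 'a set) set)
        + card (Inr ` (E - {e}) :: ('a + 'a set) set)"
      using card_Un_le add_le_mono1 order_trans by meson
    also have "\<dots> = 1 + card (incident G u - {e}) + card (E - {e})" by (simp add: card_image)
    finally have bound: "card {w \<in> S. {w, z} \<in> edges (total_graph G)}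
        \<le> 1 + card (incident G u - {e}) + card (E - {e})" .
    have "e \<in> incident G u" using u(2) uv by (auto simp: incident_def)
    then have "card (incident G u - {e}) + 1 \<le> max_degree G"
      using card_Suc_Diff1[OF finite_incident[OF G]] card_incident_le[OF G, of u]
        degree_le_max_degree[OF G uV] by fastforce
    moreover have "card (E - {e}) + 1 = card E"
      using card_Suc_Diff1[OF finE eE] by simp
    ultimately show ?thesis using bound cB cBE z(1) by force
  qed
qed

section \<open>The case col(G) > \<Delta>: sets closed under adjacency\<close>

lemma closed_set_diamond:
  assumes G: "simple_graph G" and S: "S \<subseteq> verts (total_graph G)" "S \<noteq> {}"
    and closed: "\<And>z. z \<in> S \<Longrightarrow> total_neighbors G z \<subseteq> S"
    and deg: "\<And>z. z \<in> S \<Longrightarrow> 4 \<le> card (total_neighbors G z)"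
  obtains u v w where "v \<noteq> w" "{u, v} \<in> edges G" "{u, w} \<in> edges G"
    "{Inl u, Inl v, Inr {u, v}, Inr {u, w}} \<subseteq> S"
proof -
  \<comment> \<open>If \<open>S\<close> contains an edge, closure puts the ends of that edge into
    \<open>S\<close> too.\<close>
  have "\<exists>u. Inl u \<in> S"
  proof -
    obtain z where z: "z \<in> S" using S(2) by blast
    show ?thesis
    proof (cases z)
      case (Inr e)
      then have e: "e \<in> edges G" using z S(1) by (auto simp: total_graph_verts)
      then obtain u v where uv: "e = {u, v}" using edge_cases[OF G] by metis
      then have "Inl u \<in> total_neighbors G z" using total_neighbors_edge[OF G, of u v] e Inr by auto
      then show ?thesis using closed z by blast
    qed (use z in blast)
  qed
  then obtain u where u: "Inl u \<in> S" ..
  have "card (total_neighbors G (Inl u)) \<le> card (Inl ` neighbors G u :: ('a + 'a set) set)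
      + card (Inr ` incident G u :: ('a + 'a set) set)"
    unfolding total_neighbors_vertex by (rule card_Un_le)
  also have "\<dots> = degree G u + card (incident G u)" by (simp add: card_image degree_def)
  also have "\<dots> \<le> 2 * degree G u" using card_incident_le[OF G, of u] by simp
  \<comment> \<open>The degree of \<open>u\<close> in the total graph is at most twice its degree in
    \<open>G\<close>, so 4 there forces 2 here.\<close>
  finally have "2 \<le> card (neighbors G u)" using deg[OF u] by (simp add: degree_def)
  then obtain N where "N \<subseteq> neighbors G u" "card N = 2" by (meson obtain_subset_with_card_n)
  then obtain v w where vw: "v \<noteq> w" "v \<in> neighbors G u" "w \<in> neighbors G u"
    by (auto simp: card_2_iff)
  then have "{u, v} \<in> edges G" "{u, w} \<in> edges G" by (auto simp: neighbors_def insert_commute)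
  moreover have "{Inl v, Inr {u, v}, Inr {u, w}} \<subseteq> total_neighbors G (Inl u)"
    unfolding total_neighbors_vertex using vw calculation by (auto simp: incident_def)
  ultimately show thesis using that vw(1) closed[OF u] u by blast
qed

section \<open>The bound\<close>

text \<open>The hypothesis \<Delta> \<ge> 2 excludes K_2, whose total graph is a triangle although
  \<Delta> + col - 1 = 2.\<close>

theorem theorem3:
  fixes G :: "'v ugraph"
  assumes "simple_graph G"
    and "max_degree G \<ge> 2"
  shows "total_group_choice_number TYPE('g) G \<le> max_degree G + coloring_number G - 1"
proof -
  let ?k = "max_degree G + coloring_number G - 1"
  let ?T = "total_graph G"
  note G = assms(1)
  have "group_choosable TYPE('g) ?T ?k"
    unfolding group_choosable_def
  proof (intro allI impI, elim conjE)
    fix A :: "'g monoid" and D and L :: "'v + 'v set \<Rightarrow> 'g set" and f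
    assume A: "group A" and D: "orientation ?T D"
      and L: "\<forall>z\<in>verts ?T. L z \<subseteq> carrier A \<and> finite (L z) \<and> card (L z) = ?k"
    \<comment> \<open>The hypothesis restricts lists only at elements of the total graph, while
      cancellation is used for every list. Intersecting with the carrier changes none of the
      relevant lists.\<close>
    define L' where "L' z = L z \<inter> carrier A" for z
    interpret conflict_system "\<lambda>x y. {x, y} \<in> edges ?T" L'
      "\<lambda>x \<alpha> y \<beta>. (x, y) \<in> D \<and> \<alpha> \<otimes>\<^bsub>A\<^esub> inv\<^bsub>A\<^esub> \<beta> = f {x, y} \<or> (y, x) \<in> D \<and> \<beta> \<otimes>\<^bsub>A\<^esub> inv\<^bsub>A\<^esub> \<alpha> = f {x, y}"
      by (rule conflict_system_orientation[OF A D total_graph_loopless[OF G]]) (simp add: L'_def)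
    have L': "L' z = L z" "card (L' z) = ?k" if "z \<in> verts ?T" for z
      using L that by (auto simp: L'_def Int_absorb2)
    have "\<exists>c. proper (verts ?T) c"
    proof (rule ccontr)
      assume "\<not> ?thesis"
      then obtain S where S: "S \<subseteq> verts ?T" and crit: "critical S"
        using critical_subset_exists[OF finite_total_graph[OF G]] by blast
      note ne = critical_nonempty[OF crit]
      have large: "?k \<le> card {u \<in> S. {u, z} \<in> edges ?T}" if "z \<in> S" for z
        using critical_degree[OF crit that] L'(2) S that by auto
      show False
      proof (cases "coloring_number G \<le> max_degree G")
        case True
        from total_graph_degenerate[OF G S ne this] large show False by fastforce
      next
        case False
        have finT: "finite (total_neighbors G z)" for z
          using finite_total_graph[OF G] by simp
        \<comment> \<open>Now col(G) \<ge> \<Delta> + 1, so \<open>?k\<close> is at least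
          2\<Delta>.\<close>
        have card_le: "card (total_neighbors G z) \<le> ?k" if "z \<in> S" for z
          using card_total_neighbors_le[OF G, of z] S that False by fastforce
        \<comment> \<open>The neighbors in \<open>S\<close> number at least \<open>?k\<close>, all
          neighbors at most \<open>?k\<close>; hence no neighbor lies outside
          \<open>S\<close>.\<close>
        have all: "{u \<in> S. {u, z} \<in> edges ?T} = total_neighbors G z" if "z \<in> S" for z
          using card_seteq[OF finT, of "{u \<in> S. {u, z} \<in> edges ?T}" z] S large[OF that] card_le[OF that]
          by fastforce
        \<comment> \<open>This is where \<Delta> \<ge> 2 is used: \<open>?k\<close> \<ge> 2\<Delta>
          \<ge> 4.\<close>
        have 4: "4 \<le> card (total_neighbors G z)" if "z \<in> S" for z
          using large[OF that] all[OF that] False assms(2) by simp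
        have closed: "total_neighbors G z \<subseteq> S" if "z \<in> S" for z
          unfolding all[OF that, symmetric] by (rule Collect_restrict)
        obtain u v w where uvw: "v \<noteq> w" "{u, v} \<in> edges G" "{u, w} \<in> edges G"
          "{Inl u, Inl v, Inr {u, v}, Inr {u, w}} \<subseteq> S"
          by (rule closed_set_diamond[OF G S ne closed 4])
        have neq: "u \<noteq> v" "u \<noteq> w" using uvw edge_neq[OF G] by blast+
        have edges_neq: "{u, v} \<noteq> {u, w}" using uvw(1) by (auto simp: doubleton_eq_iff)
        show False
        proof (rule critical_no_diamond[OF crit, of "Inl u" "Inr {u, v}" "Inl v" "Inr {u, w}"])
          show "card {x \<in> S. {x, z} \<in> edges ?T} \<le> card (L' z)"
            if "z \<in> {Inl u, Inr {u, v}, Inl v, Inr {u, w}}" for z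
          proof -
            have "z \<in> S" using that uvw(4) by auto
            then show ?thesis using all card_le L'(2) S by auto
          qed
        qed (use uvw neq edges_neq in \<open>auto simp: total_graph_adj incident_def insert_commute\<close>)
      qed
    qed
    then obtain c where c: "proper (verts ?T) c" ..
    have "c x \<otimes>\<^bsub>A\<^esub> inv\<^bsub>A\<^esub> c y \<noteq> f {x, y}" if "(x, y) \<in> D" for x y
    proof -
      have "{x, y} \<in> edges ?T" using D that by (auto simp: orientation_def)
      then have "x \<in> verts ?T" "y \<in> verts ?T"
        using total_graph_edge_verts[OF G, of x y] total_graph_edge_verts[OF G, of y x]
        by (simp_all add: insert_commute)
      then show ?thesis using c that by (auto simp: proper_def)
    qed
    then have "group_coloring ?T D A L f c"
      using c L'(1) by (auto simp: group_coloring_def proper_def)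
    then show "\<exists>c. group_coloring ?T D A L f c" by (intro exI[of _ c])
  qed
  then show ?thesis
    unfolding total_group_choice_number_def group_choice_number_def by (rule Least_le)
qed

end
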